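(* Let $k\ge2$ and let $S\subseteq\mathbf{N}$ be completely multiplicative such that $\#\{n\in S: n\le x\}=Ax+O(1)$ for some constant $A$. Then $$\#\{(n_1,\dots,n_k)\in(S\cap[1,x])^k:\operatorname{gcud}(n_1,\dots,n_k)=1\}=A^k\beta_k(S)\,x^k+T_k(x),$$ where $$\beta_k(S)=\prod_{p\in S}\Bigl(1-\frac{(p-1)^k}{p^k(p^k-1)}\Bigr)$$ (product over primes $p$ belonging to $S$), and $T_k(x)=O(x^{k-1})$ for $k>2$, $T_2(x)=O(x\log^2x)$ for $k=2$. Moreover, if $Q_k^S(n)$ denotes the probability that for an ordered $k$-tuple $(n_1,\dots,n_k)$ chosen uniformly at random from $(S\cap[1,n])^k$ one has $\operatorname{gcud}(n_1,\dots,n_k)=1$, then $\lim_{n\to\infty}Q_k^S(n)=\beta_k(S)$.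
   Context: For $d,n\in\mathbf{N}$, $d$ is a unitary divisor of $n$ if $d\mid n$ and $\gcd(d,n/d)=1$; $\operatorname{gcud}(n_1,\dots,n_k)$ denotes the greatest common unitary divisor of $n_1,\dots,n_k$. A set $S\subseteq\mathbf{N}$ is called completely multiplicative if $1\in S$ and its characteristic function $\rho_S$ is completely multiplicative. *)

theory Defs
  imports "HOL-Probability.Probability" "HOL-Library.Landau_Symbols"
    "HOL-Computational_Algebra.Primes"
begin

text \<open>The natural numbers of the paper are the positive integers, whereas \<^typ>\<open>nat\<close> contains \<open>0\<close>.
  Positivity is therefore imposed explicitly wherever it matters.\<close>

definition unitary_divisor :: "nat \<Rightarrow> nat \<Rightarrow> bool" where
  "unitary_divisor d n \<longleftrightarrow> d dvd n \<and> gcd d (n div d) = 1"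

text \<open>For a nonempty list of positive integers the set below is finite and contains \<open>1\<close>,
  so the maximum is meaningful; on other lists the value is irrelevant.\<close>

definition gcud :: "nat list \<Rightarrow> nat" where
  "gcud ns = Max {d. \<forall>n\<in>set ns. unitary_divisor d n}"

definition completely_multiplicative :: "(nat \<Rightarrow> nat) \<Rightarrow> bool" where
  "completely_multiplicative f \<longleftrightarrow> (\<forall>m>0. \<forall>n>0. f (m * n) = f m * f n)"

definition completely_multiplicative_set :: "nat set \<Rightarrow> bool" where
  "completely_multiplicative_set S \<longleftrightarrow>
     S \<subseteq> {0<..} \<and> 1 \<in> S \<and> completely_multiplicative (indicator S)"

text \<open>Ordered \<open>k\<close>-tuples are lists of length \<open>k\<close>; \<open>x\<close> is a real number.\<close>

definition tuples :: "nat set \<Rightarrow> nat \<Rightarrow> real \<Rightarrow> nat list set" where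
  "tuples S k x = {ns. length ns = k \<and> set ns \<subseteq> {n \<in> S. 1 \<le> real n \<and> real n \<le> x}}"

text \<open>The product over the primes in \<open>S\<close> is indexed by all natural numbers, the other indices
  contributing the factor \<open>1\<close>.\<close>

definition gcud_factor :: "nat \<Rightarrow> nat set \<Rightarrow> nat \<Rightarrow> real" where
  "gcud_factor k S p =
     (if prime p \<and> p \<in> S then 1 - (real p - 1) ^ k / (real p ^ k * (real p ^ k - 1)) else 1)"

definition gcud_beta :: "nat \<Rightarrow> nat set \<Rightarrow> real" where
  "gcud_beta k S = (\<Prod>p. gcud_factor k S p)"

text \<open>\<^const>\<open>prodinf\<close> is unspecified for divergent products; here the product converges absolutely.\<close>

lemma abs_convergent_prod_gcud_factor:
  assumes "k \<ge> 2"
  shows "abs_convergent_prod (gcud_factor k S)"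
proof -
  have "norm (norm (gcud_factor k S p - 1)) \<le> 1 / (real p - 1) ^ 2" if "p \<ge> 2" for p
  proof (cases "prime p \<and> p \<in> S")
    case True
    define q where "q = real p"
    have q: "q \<ge> 2" using that by (simp add: q_def)
    have "(q - 1) ^ 2 \<le> (q - 1) ^ k"
      using q assms by (intro power_increasing) auto
    have "(q - 1) ^ k \<le> q ^ k" using q by (intro power_mono) auto
    moreover have "(q - 1) ^ 2 \<le> q ^ k - 1"
    proof -
      have "q ^ 2 \<le> q ^ k" using q assms by (intro power_increasing) auto
      moreover have "(q - 1) ^ 2 \<le> q ^ 2 - 1" using q by (simp add: power2_eq_square algebra_simps)
      ultimately show ?thesis by linarith
    qed
    moreover have "(q - 1) ^ 2 > 0" using q by simp
    ultimately have "(q - 1) ^ k / (q ^ k * (q ^ k - 1)) \<le> q ^ k / (q ^ k * (q - 1) ^ 2)"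
      using q by (intro frac_le mult_left_mono mult_pos_pos) auto
    also have "\<dots> = 1 / (q - 1) ^ 2" using q by simp
    finally have "(q - 1) ^ k / (q ^ k * (q ^ k - 1)) \<le> 1 / (q - 1) ^ 2" .
    moreover have "(q - 1) ^ k / (q ^ k * (q ^ k - 1)) \<ge> 0"
      using q by (intro divide_nonneg_nonneg mult_nonneg_nonneg) auto
    ultimately have "norm (- ((q - 1) ^ k / (q ^ k * (q ^ k - 1)))) \<le> 1 / (q - 1) ^ 2"
      unfolding real_norm_def abs_minus_cancel by linarith
    moreover have "gcud_factor k S p - 1 = - ((q - 1) ^ k / (q ^ k * (q ^ k - 1)))"
      using True by (simp add: gcud_factor_def q_def)
    ultimately show ?thesis by (simp only: real_norm_def abs_idempotent q_def)
  qed (auto simp: gcud_factor_def)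
  then have "\<exists>N. \<forall>p\<ge>N. norm (norm (gcud_factor k S p - 1)) \<le> 1 / (real p - 1) ^ 2"
    by blast
  moreover have "summable (\<lambda>p. 1 / (real p - 1) ^ 2)"
    using inverse_power_summable[of 2, where ?'a = real]
    by (subst summable_Suc_iff [symmetric]) (simp add: inverse_eq_divide)
  ultimately have "summable (\<lambda>p. norm (gcud_factor k S p - 1))"
    by (rule summable_comparison_test)
  then show ?thesis by (simp add: abs_convergent_prod_conv_summable)
qed

definition gcud_prob :: "nat \<Rightarrow> nat set \<Rightarrow> nat \<Rightarrow> real" where
  "gcud_prob k S n = measure_pmf.prob (pmf_of_set (tuples S k (real n))) {ns. gcud ns = 1}"

end

theory Submission
  imports Defs "HOL-Real_Asymp.Real_Asymp"
begin

text \<open>Summing \<open>(-1)\<close> to the number of prime factors of \<open>d\<close> over all common unitary divisors \<open>d\<close> of a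
  tuple detects whether the tuple has gcud \<open>1\<close>. Hence the count is an alternating sum over
  \<open>d \<in> S\<close>, \<open>d \<le> x\<close>, of the \<open>k\<close>-th powers of the number of \<open>m \<in> S\<close>, \<open>m \<le> x / d\<close>, coprime to \<open>d\<close>.
  Sieving out one prime factor of \<open>d\<close> after the other keeps the sieve inside \<open>S\<close> and doubles the
  error at each step, so that this number is \<open>A (x / d) \<Prod>\<^bsub>p | d\<^esub> (1 - 1 / p)\<close> up to \<open>O(2\<^bsup>\<omega>(d)\<^esup>)\<close>. The errors
  add up to \<open>O(x\<^bsup>k-1\<^esup> \<Sum>\<^bsub>d \<le> x\<^esub> 2\<^bsup>\<omega>(d)\<^esup> / d\<^bsup>k-1\<^esup>)\<close>, which is controlled by the square of
  \<open>\<Sum>\<^bsub>m \<le> x\<^esub> 1 / m\<^bsup>k-1\<^esup>\<close>; the main terms form a series with Euler product \<open>\<beta>\<^sub>k(S)\<close>.\<close>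

section \<open>Common unitary divisors\<close>

lemma coprime_iff_prime_factors_not_dvd:
  fixes d m :: nat
  assumes "d > 0"
  shows "coprime d m \<longleftrightarrow> (\<forall>p\<in>prime_factors d. \<not> p dvd m)"
proof
  assume "coprime d m"
  then show "\<forall>p\<in>prime_factors d. \<not> p dvd m"
    by (metis coprime_common_divisor in_prime_factors_iff not_prime_unit)
next
  assume r: "\<forall>p\<in>prime_factors d. \<not> p dvd m"
  show "coprime d m"
  proof (rule ccontr)
    assume "\<not> coprime d m"
    then obtain p where "prime p" "p dvd gcd d m"
      using prime_factor_nat by (metis coprime_iff_gcd_eq_1)
    then show False using r assms by (auto simp: prime_factors_dvd)
  qed
qed

text \<open>In \<open>n = d * e\<close>, a prime of \<open>d\<close> has the same exponent in
  \<open>n\<close> and in \<open>d\<close> exactly when it does not divide \<open>e\<close>; over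
  all primes of \<open>d\<close> this is coprimality. A unitary divisor thus takes each prime power
  of \<open>n\<close> whole or not at all, which reduces common unitary divisors to sets of
  primes.\<close>

lemma unitary_divisor_iff_multiplicity:
  assumes "n > 0"
  shows "unitary_divisor d n \<longleftrightarrow>
    d > 0 \<and> (\<forall>p\<in>prime_factors d. multiplicity p n = multiplicity p d)"
proof
  assume u: "unitary_divisor d n"
  then have dn: "d dvd n" and g: "coprime d (n div d)"
    by (auto simp: unitary_divisor_def coprime_iff_gcd_eq_1)
  define e where "e = n div d"
  have n: "n = d * e" using dn by (simp add: e_def)
  have pos: "d > 0" "e > 0" using assms by (auto simp: n)
  have "multiplicity p n = multiplicity p d" if p: "p \<in> prime_factors d" for p
  proof -
    have "prime p" "p dvd d" using p by auto
    then have "\<not> p dvd e" using g unfolding e_def[symmetric]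
      by (meson coprime_common_divisor not_prime_unit)
    then show ?thesis
      using pos \<open>prime p\<close> by (simp add: n prime_elem_multiplicity_mult_distrib not_dvd_imp_multiplicity_0)
  qed
  then show "d > 0 \<and> (\<forall>p\<in>prime_factors d. multiplicity p n = multiplicity p d)"
    using pos by blast
next
  assume r: "d > 0 \<and> (\<forall>p\<in>prime_factors d. multiplicity p n = multiplicity p d)"
  have dn: "d dvd n"
  proof (rule multiplicity_le_imp_dvd)
    fix p :: nat assume "prime p"
    then show "multiplicity p d \<le> multiplicity p n"
      using r by (cases "p \<in> prime_factors d") (auto simp: prime_factors_multiplicity)
  qed (use r in simp)
  define e where "e = n div d"
  have n: "n = d * e" using dn by (simp add: e_def)
  have pos: "d > 0" "e > 0" using assms by (auto simp: n)
  have "coprime d e"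
  proof (rule ccontr)
    assume "\<not> coprime d e"
    then obtain p where p: "prime p" "p dvd d" "p dvd e"
      using pos by (auto simp: coprime_iff_prime_factors_not_dvd prime_factors_dvd)
    then have "multiplicity p n = multiplicity p d" using r by (auto simp: prime_factors_dvd)
    moreover have "multiplicity p n = multiplicity p d + multiplicity p e"
      using pos p by (simp add: n prime_elem_multiplicity_mult_distrib)
    moreover have "multiplicity p e > 0" using p pos by (simp add: prime_multiplicity_gt_zero_iff)
    ultimately show False by simp
  qed
  then show "unitary_divisor d n" using dn
    by (simp add: unitary_divisor_def e_def coprime_iff_gcd_eq_1)
qed

definition common_unitary_divisors :: "nat list \<Rightarrow> nat set" where
  "common_unitary_divisors ns = {d. \<forall>n\<in>set ns. unitary_divisor d n}"

lemma finite_common_unitary_divisors: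
  assumes "ns \<noteq> []" "\<forall>n\<in>set ns. n > 0"
  shows "finite (common_unitary_divisors ns)"
proof (rule finite_subset)
  show "common_unitary_divisors ns \<subseteq> {d. d dvd hd ns}"
    using assms by (auto simp: common_unitary_divisors_def unitary_divisor_def)
  show "finite {d. d dvd hd ns}" using assms by simp
qed

lemma one_in_common_unitary_divisors: "1 \<in> common_unitary_divisors ns"
  by (auto simp: common_unitary_divisors_def unitary_divisor_def)

lemma gcud_eq_1_iff:
  assumes "ns \<noteq> []" "\<forall>n\<in>set ns. n > 0"
  shows "gcud ns = 1 \<longleftrightarrow> common_unitary_divisors ns = {1}"
proof
  have fin: "finite (common_unitary_divisors ns)"
    by (rule finite_common_unitary_divisors[OF assms])
  have gc: "gcud ns = Max (common_unitary_divisors ns)"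
    by (simp add: gcud_def common_unitary_divisors_def)
  show "gcud ns = 1" if "common_unitary_divisors ns = {1}"
    using that by (simp add: gc)
  assume m: "gcud ns = 1"
  have "d = 1" if d: "d \<in> common_unitary_divisors ns" for d
  proof -
    have "d \<le> 1" using Max_ge[OF fin d] m gc by simp
    \<comment> \<open>The maximum bounds \<open>d\<close> only from above, so \<open>d = 0\<close>
      has to be excluded; it divides no positive number.\<close>
    moreover have "d > 0"
      using d assms unitary_divisor_iff_multiplicity
      by (metis (mono_tags) common_unitary_divisors_def hd_in_set mem_Collect_eq)
    ultimately show ?thesis by simp
  qed
  then show "common_unitary_divisors ns = {1}"
    using one_in_common_unitary_divisors by blast
qed

text \<open>Expanding \<open>\<Prod>x\<in>A. (-1) + 1\<close> by choosing one summand in each factor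
  yields one term per subset \<open>R\<close>, and the product vanishes as soon as \<open>A\<close>
  has an element.\<close>

lemma sum_alternating_Pow:
  assumes "finite A"
  shows "(\<Sum>R\<in>Pow A. (-1) ^ card R) = (if A = {} then 1 else 0 :: real)"
proof -
  have "(\<Sum>R\<in>Pow A. (-1) ^ card R) = (\<Prod>x\<in>A. (-1) + (1::real))"
    by (subst prod_add[OF assms]) simp
  then show ?thesis using assms by (cases "A = {}") (auto simp: card_gt_0_iff)
qed

text \<open>A common unitary divisor is determined by its set of prime factors, which is an arbitrary
  subset of the set of primes that divide all entries with the same positive exponent.\<close>

lemma sum_common_unitary_divisors:
  assumes "ns \<noteq> []" "\<forall>n\<in>set ns. n > 0"
  shows "(\<Sum>d\<in>common_unitary_divisors ns. (-1) ^ card (prime_factors d)) =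
    (if gcud ns = 1 then 1 else 0 :: real)"
proof -
  define n0 where "n0 = hd ns"
  have n0: "n0 \<in> set ns" "n0 > 0" using assms by (auto simp: n0_def)
  define C where "C = common_unitary_divisors ns"
  define Q where "Q = {p \<in> prime_factors n0. \<forall>n\<in>set ns. multiplicity p n = multiplicity p n0}"
  \<comment> \<open>\<open>G\<close> inverts \<open>prime_factors\<close> on \<open>C\<close>: each
    chosen prime gets its whole exponent in \<open>n0\<close>, which for primes in \<open>Q\<close>
    is its exponent in every entry.\<close>
  define G where "G = (\<lambda>R. \<Prod>p\<in>R. p ^ multiplicity p n0)"
  have finQ: "finite Q" by (simp add: Q_def)
  have C_iff: "d \<in> C \<longleftrightarrow>
      d > 0 \<and> (\<forall>n\<in>set ns. \<forall>p\<in>prime_factors d. multiplicity p n = multiplicity p d)" for d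
    using assms n0 unitary_divisor_iff_multiplicity
    unfolding C_def common_unitary_divisors_def by auto
  have mult_G: "multiplicity p (G R) = (if p \<in> R then multiplicity p n0 else 0)"
    if "R \<subseteq> Q" "prime p" for R p
    unfolding G_def using that finQ
    by (intro multiplicity_prod_prime_powers) (auto simp: Q_def dest: finite_subset)
  have pf_G: "prime_factors (G R) = R" if "R \<subseteq> Q" for R
    using that mult_G[OF that] by (auto simp: prime_factors_multiplicity Q_def split: if_splits)
  have bij: "bij_betw prime_factors C (Pow Q)"
  proof (rule bij_betw_byWitness[where f' = G])
    show "\<forall>d\<in>C. G (prime_factors d) = d"
    proof
      fix d assume d: "d \<in> C"
      have "G (prime_factors d) = (\<Prod>p\<in>prime_factors d. p ^ multiplicity p d)"
        unfolding G_def using d n0 by (intro prod.cong) (auto simp: C_iff)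
      also have "\<dots> = d" using d by (simp add: prod_prime_factors C_iff)
      finally show "G (prime_factors d) = d" .
    qed
    show "\<forall>R\<in>Pow Q. prime_factors (G R) = R" using pf_G by blast
    show "prime_factors ` C \<subseteq> Pow Q"
    proof clarify
      fix d p assume d: "d \<in> C" and p: "p \<in> prime_factors d"
      have "\<forall>n\<in>set ns. multiplicity p n = multiplicity p d" using d p by (auto simp: C_iff)
      moreover have "multiplicity p d > 0" "prime p" using p by (auto simp: prime_factors_multiplicity)
      ultimately show "p \<in> Q" using n0 by (auto simp: Q_def prime_factors_multiplicity)
    qed
    show "G ` Pow Q \<subseteq> C"
    proof clarify
      fix R assume R: "R \<subseteq> Q"
      have "G R > 0" unfolding G_def using R
        by (intro prod_pos zero_less_power) (auto simp: Q_def dest!: subsetD intro: prime_gt_0_nat)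
      moreover have "multiplicity p n = multiplicity p (G R)"
        if "n \<in> set ns" "p \<in> prime_factors (G R)" for n p
      proof -
        have "p \<in> R" using that pf_G[OF R] by simp
        then show ?thesis using R that by (subst mult_G) (auto simp: Q_def)
      qed
      ultimately show "G R \<in> C" by (auto simp: C_iff)
    qed
  qed
  have "(\<Sum>d\<in>C. (-1) ^ card (prime_factors d)) = (\<Sum>R\<in>Pow Q. (-1) ^ card R :: real)"
    by (rule sum.reindex_bij_betw[OF bij])
  also have "\<dots> = (if Q = {} then 1 else 0)" by (rule sum_alternating_Pow[OF finQ])
  \<comment> \<open>Both sides are compared by cardinality: the bijection gives \<open>C\<close> the
    size of \<open>Pow Q\<close>, which is 1 only for empty \<open>Q\<close>, and a single element
    of \<open>C\<close> can only be 1.\<close>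
  also have "Q = {} \<longleftrightarrow> C = {1}"
  proof
    assume "Q = {}"
    then have "card C = 1" using bij_betw_same_card[OF bij] by simp
    then show "C = {1}" using one_in_common_unitary_divisors[of ns] C_def
      by (metis card_1_singletonE singletonD)
  next
    assume "C = {1}"
    then have "card (Pow Q) = 1" using bij_betw_same_card[OF bij] by simp
    then show "Q = {}" using finQ by (simp add: card_Pow)
  qed
  finally show ?thesis using gcud_eq_1_iff[OF assms] by (simp add: C_def)
qed

section \<open>Sieving a completely multiplicative set\<close>

lemma completely_multiplicative_set_mult_iff:
  assumes "completely_multiplicative_set S" "m > 0" "n > 0"
  shows "m * n \<in> S \<longleftrightarrow> m \<in> S \<and> n \<in> S"
proof -
  have "(indicator S (m * n) :: nat) = indicator S m * indicator S n"
    using assms by (simp add: completely_multiplicative_set_def completely_multiplicative_def)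
  then show ?thesis by (cases "m \<in> S"; cases "n \<in> S"; cases "m * n \<in> S"; simp)
qed

lemma completely_multiplicative_set_pos:
  "completely_multiplicative_set S \<Longrightarrow> n \<in> S \<Longrightarrow> n > 0"
  by (auto simp: completely_multiplicative_set_def)

text \<open>\<open>S\<close> is closed under products and divisors, so it is the monoid generated by
  its primes. This lets the restriction to \<open>d \<in> S\<close> pass to the local factors of the
  Euler product.\<close>

lemma completely_multiplicative_set_iff_prime_factors:
  assumes "completely_multiplicative_set S" "n > 0"
  shows "n \<in> S \<longleftrightarrow> prime_factors n \<subseteq> S"
  using assms(2)
proof (induction n rule: prime_divisors_induct)
  case (unit n)
  then show ?case using assms(1) by (simp add: completely_multiplicative_set_def)
next
  case (factor p n)
  then show ?case using completely_multiplicative_set_mult_iff[OF assms(1), of p n]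
    by (auto simp: prime_gt_0_nat prime_factors_product prime_prime_factors)
qed simp

text \<open>The sieve is indexed by a set of primes instead of a modulus so that primes can be added
  singly; the bound is real because it gets divided by primes along the way.\<close>

definition sieved_count :: "nat set \<Rightarrow> nat set \<Rightarrow> real \<Rightarrow> nat" where
  "sieved_count S P y = card {m \<in> S. real m \<le> y \<and> (\<forall>p\<in>P. \<not> p dvd m)}"

lemma finite_real_le_Collect: "finite {m::nat. real m \<le> y \<and> Q m}"
  by (rule finite_subset[of _ "{..nat \<lfloor>y\<rfloor>}"]) (auto simp: le_nat_floor)

text \<open>The elements that survive \<open>P\<close> but are divisible by \<open>p\<close> are the
  products \<open>p * r\<close> with \<open>r\<close> counted up to \<open>y / p\<close>:
  multiplicativity keeps \<open>r\<close> in \<open>S\<close>, and no prime of \<open>P\<close>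
  divides \<open>p\<close>. Since \<open>p\<close> may divide \<open>r\<close> again, the last count
  is sieved by \<open>P\<close> only.\<close>

lemma sieved_count_insert:
  assumes S: "completely_multiplicative_set S" and P: "\<forall>q\<in>P. prime q"
    and p: "prime p" "p \<in> S" "p \<notin> P"
  shows "sieved_count S P y = sieved_count S (insert p P) y + sieved_count S P (y / real p)"
proof -
  define B where "B = {m \<in> S. real m \<le> y \<and> (\<forall>q\<in>insert p P. \<not> q dvd m)}"
  define D where "D = {m \<in> S. real m \<le> y / real p \<and> (\<forall>q\<in>P. \<not> q dvd m)}"
  have fin: "finite B" "finite D"
    unfolding B_def D_def
    by (rule finite_subset[OF _ finite_real_le_Collect[where Q = "\<lambda>_. True"]]; auto)+
  have ppos: "p > 0" using p by (simp add: prime_gt_0_nat)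
  have ndvd: "\<not> q dvd p" if "q \<in> P" for q
    using that P p by (metis primes_dvd_imp_eq)
  have "{m \<in> S. real m \<le> y \<and> (\<forall>q\<in>P. \<not> q dvd m)} = B \<union> (\<lambda>m. p * m) ` D"
  proof (intro equalityI subsetI)
    fix m assume m: "m \<in> {m \<in> S. real m \<le> y \<and> (\<forall>q\<in>P. \<not> q dvd m)}"
    show "m \<in> B \<union> (\<lambda>m. p * m) ` D"
    proof (cases "p dvd m")
      case True
      then obtain r where r: "m = p * r" by auto
      have "m > 0" using m completely_multiplicative_set_pos[OF S] by auto
      then have "r \<in> S" using m r completely_multiplicative_set_mult_iff[OF S, of p r] by auto
      moreover have "real r \<le> y / real p" using m r ppos by (simp add: field_simps)
      moreover have "\<forall>q\<in>P. \<not> q dvd r" using m r by auto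
      ultimately show ?thesis using r unfolding D_def by blast
    qed (use m in \<open>auto simp: B_def\<close>)
  next
    fix m assume "m \<in> B \<union> (\<lambda>m. p * m) ` D"
    then show "m \<in> {m \<in> S. real m \<le> y \<and> (\<forall>q\<in>P. \<not> q dvd m)}"
    proof
      assume "m \<in> (\<lambda>m. p * m) ` D"
      then obtain r where r: "m = p * r" "r \<in> S" "real r \<le> y / real p" "\<forall>q\<in>P. \<not> q dvd r"
        by (auto simp: D_def)
      have "m \<in> S"
        using r p ppos completely_multiplicative_set_mult_iff[OF S, of p r]
          completely_multiplicative_set_pos[OF S] by auto
      moreover have "real m \<le> y" using r ppos by (simp add: field_simps)
      moreover have "\<not> q dvd m" if "q \<in> P" for q
        using that r P ndvd by (auto simp: prime_dvd_mult_iff)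
      ultimately show ?thesis by auto
    qed (auto simp: B_def)
  qed
  moreover have "B \<inter> (\<lambda>m. p * m) ` D = {}" by (auto simp: B_def)
  ultimately have "card {m \<in> S. real m \<le> y \<and> (\<forall>q\<in>P. \<not> q dvd m)} = card B + card D"
    using fin ppos by (simp add: card_Un_disjoint card_image inj_on_def)
  then show ?thesis by (simp only: sieved_count_def B_def D_def)
qed

text \<open>In the recursion \<open>sieved_count_insert\<close> the main terms combine to the factor
  \<open>1 - 1 / p\<close> while the two errors add up. As it visits the smaller arguments
  \<open>y / p\<close>, the induction generalises \<open>y\<close>, and \<open>C\<close> must serve
  all \<open>y \<ge> 0\<close>.\<close>

lemma sieved_count_estimate:
  assumes S: "completely_multiplicative_set S"
    and C: "\<And>y. y \<ge> 0 \<Longrightarrow> \<bar>real (card {n \<in> S. real n \<le> y}) - A * y\<bar> \<le> C"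
    and P: "finite P" "\<forall>p\<in>P. prime p \<and> p \<in> S" and y: "y \<ge> 0"
  shows "\<bar>real (sieved_count S P y) - A * y * (\<Prod>p\<in>P. 1 - 1 / real p)\<bar> \<le> C * 2 ^ card P"
  using P y
proof (induction P arbitrary: y)
  case empty
  then show ?case using C[of y] by (simp add: sieved_count_def)
next
  case (insert p P)
  define M where "M = (\<Prod>p\<in>P. 1 - 1 / real p)"
  have p: "prime p" "p \<in> S" using insert by auto
  then have ppos: "real p > 0" by (simp add: prime_gt_0_nat)
  have rec: "real (sieved_count S P y) =
      real (sieved_count S (insert p P) y) + real (sieved_count S P (y / real p))"
    using sieved_count_insert[OF S _ p, of P y] insert by simp
  have "\<bar>real (sieved_count S P y) - A * y * M\<bar> \<le> C * 2 ^ card P"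
    unfolding M_def using insert by (intro insert.IH) auto
  moreover have "\<bar>real (sieved_count S P (y / real p)) - A * (y / real p) * M\<bar> \<le> C * 2 ^ card P"
    unfolding M_def using insert by (intro insert.IH) auto
  moreover have "A * y * (\<Prod>p\<in>insert p P. 1 - 1 / real p) = A * y * M - A * (y / real p) * M"
    using insert by (simp add: M_def algebra_simps)
  moreover have "C * 2 ^ card (insert p P) = C * 2 ^ card P + C * 2 ^ card P"
    using insert by simp
  moreover have "\<bar>u - (x - z)\<bar> \<le> e + e"
    if "\<bar>v - x\<bar> \<le> e" "\<bar>w - z\<bar> \<le> e" "v = u + w" for u v w x z e :: real
    using that by linarith
  ultimately show ?case using rec by metis
qed

text \<open>The unitary multiples of \<open>d\<close> are the \<open>d * m\<close> with
  \<open>m\<close> free of the primes of \<open>d\<close>. If \<open>d \<notin> S\<close> none of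
  them lies in \<open>S\<close>, which contains the divisors of its elements.\<close>

lemma card_unitary_multiples:
  assumes S: "completely_multiplicative_set S" and d: "d > 0"
  shows "card {n \<in> S. real n \<le> x \<and> unitary_divisor d n} =
    (if d \<in> S then sieved_count S (prime_factors d) (x / real d) else 0)"
proof (cases "d \<in> S")
  case True
  define D where "D = {m \<in> S. real m \<le> x / real d \<and> (\<forall>p\<in>prime_factors d. \<not> p dvd m)}"
  note cop = coprime_iff_prime_factors_not_dvd[OF d]
  have "{n \<in> S. real n \<le> x \<and> unitary_divisor d n} = (\<lambda>m. d * m) ` D"
  proof (intro equalityI subsetI)
    fix n assume n: "n \<in> {n \<in> S. real n \<le> x \<and> unitary_divisor d n}"
    then have "d dvd n" and c: "coprime d (n div d)"
      by (auto simp: unitary_divisor_def coprime_iff_gcd_eq_1)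
    then obtain m where m: "n = d * m" by auto
    have "n > 0" using n completely_multiplicative_set_pos[OF S] by auto
    then have "m \<in> S" using n m d completely_multiplicative_set_mult_iff[OF S, of d m] by auto
    moreover have "real m \<le> x / real d" using n m d by (simp add: field_simps)
    moreover have "coprime d m" using c m d by simp
    ultimately show "n \<in> (\<lambda>m. d * m) ` D" using m cop by (auto simp: D_def)
  next
    fix n assume "n \<in> (\<lambda>m. d * m) ` D"
    then obtain m where m: "n = d * m" "m \<in> S" "real m \<le> x / real d" "coprime d m"
      unfolding D_def cop[symmetric] by auto
    have "n \<in> S"
      using m True d completely_multiplicative_set_mult_iff[OF S, of d m]
        completely_multiplicative_set_pos[OF S] by auto
    moreover have "real n \<le> x" using m d by (simp add: field_simps)
    ultimately show "n \<in> {n \<in> S. real n \<le> x \<and> unitary_divisor d n}"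
      using m d by (simp add: unitary_divisor_def coprime_iff_gcd_eq_1[symmetric])
  qed
  then show ?thesis using d True
    by (simp add: sieved_count_def D_def[symmetric] card_image inj_on_def)
next
  case False
  have "{n \<in> S. real n \<le> x \<and> unitary_divisor d n} = {}"
  proof (intro equals0I)
    fix n assume n: "n \<in> {n \<in> S. real n \<le> x \<and> unitary_divisor d n}"
    then obtain m where m: "n = d * m" by (auto simp: unitary_divisor_def)
    have "n > 0" using n completely_multiplicative_set_pos[OF S] by auto
    then show False using n m d False completely_multiplicative_set_mult_iff[OF S, of d m] by auto
  qed
  then show ?thesis using False by (simp only: card.empty if_False)
qed

section \<open>Counting tuples through their common unitary divisors\<close>

lemma tuples_eq:
  assumes "completely_multiplicative_set S"
  shows "tuples S k x = {ns. set ns \<subseteq> {n \<in> S. real n \<le> x} \<and> length ns = k}"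
  using completely_multiplicative_set_pos[OF assms] by (fastforce simp: tuples_def)

lemma finite_tuples: "finite (tuples S k x)"
proof -
  have "finite {n \<in> S. 1 \<le> real n \<and> real n \<le> x}"
    by (rule finite_subset[OF _ finite_real_le_Collect[where Q = "\<lambda>_. True"]]) auto
  from finite_lists_length_eq[OF this, of k] show ?thesis
    unfolding tuples_def by (rule finite_subset[rotated]) auto
qed

lemma card_tuples:
  assumes "completely_multiplicative_set S"
  shows "card (tuples S k x) = card {n \<in> S. real n \<le> x} ^ k"
  unfolding tuples_eq[OF assms]
  by (rule card_lists_length_eq, rule finite_subset[OF _ finite_real_le_Collect[where Q = "\<lambda>_. True"]]) auto

text \<open>The indicator of gcud 1 is replaced by the alternating sum over common unitary divisors,
  and the sums are exchanged. For fixed \<open>d\<close> the condition constrains each entry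
  separately, which produces the \<open>k\<close>-th power.\<close>

lemma card_gcud_tuples:
  assumes S: "completely_multiplicative_set S" and k: "k > 0"
  shows "real (card {ns \<in> tuples S k x. gcud ns = 1}) =
    (\<Sum>d\<in>{d\<in>{1..nat \<lfloor>x\<rfloor>}. d \<in> S}. (-1) ^ card (prime_factors d) *
       real (sieved_count S (prime_factors d) (x / real d)) ^ k)"
proof -
  define I where "I = {1..nat \<lfloor>x\<rfloor>}"
  have tup: "ns \<noteq> []" "\<forall>n\<in>set ns. n > 0" if "ns \<in> tuples S k x" for ns
    using that k by (auto simp: tuples_def)
  \<comment> \<open>A common unitary divisor is at most the first entry, hence at most
    \<open>x\<close>. This gives an index set independent of the tuple, as the exchange of sums
    requires.\<close>
  have sub: "common_unitary_divisors ns \<subseteq> I" if ns: "ns \<in> tuples S k x" for ns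
  proof
    fix d assume d: "d \<in> common_unitary_divisors ns"
    have h: "hd ns \<in> set ns" using tup[OF ns] by simp
    then have "hd ns \<in> {n \<in> S. 1 \<le> real n \<and> real n \<le> x}" using ns unfolding tuples_def by blast
    then have "d dvd hd ns" "hd ns > 0" "real (hd ns) \<le> x"
      using d h by (auto simp: common_unitary_divisors_def unitary_divisor_def)
    then have "d > 0" "d \<le> hd ns" "hd ns \<le> nat \<lfloor>x\<rfloor>"
      by (auto simp: le_nat_floor dvd_imp_le intro: Nat.gr0I)
    then show "d \<in> I" by (simp add: I_def)
  qed
  have "real (card {ns \<in> tuples S k x. gcud ns = 1}) =
      (\<Sum>ns\<in>tuples S k x. if gcud ns = 1 then 1 else 0)"
    using finite_tuples by (simp add: sum.If_cases Int_def)
  also have "\<dots> = (\<Sum>ns\<in>tuples S k x. \<Sum>d\<in>common_unitary_divisors ns. (-1) ^ card (prime_factors d))"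
    by (intro sum.cong refl) (simp add: sum_common_unitary_divisors tup)
  also have "\<dots> = (\<Sum>ns\<in>tuples S k x. \<Sum>d\<in>I. if d \<in> common_unitary_divisors ns
       then (-1) ^ card (prime_factors d) else 0)"
  proof (rule sum.cong[OF refl])
    fix ns assume "ns \<in> tuples S k x"
    from Int_absorb1[OF sub[OF this]]
    show "(\<Sum>d\<in>common_unitary_divisors ns. (-1) ^ card (prime_factors d) :: real) =
        (\<Sum>d\<in>I. if d \<in> common_unitary_divisors ns then (-1) ^ card (prime_factors d) else 0)"
      by (subst sum.inter_restrict[symmetric]) (simp_all add: I_def)
  qed
  also have "\<dots> = (\<Sum>d\<in>I. \<Sum>ns\<in>tuples S k x. if d \<in> common_unitary_divisors ns
       then (-1) ^ card (prime_factors d) else 0)"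
    by (rule sum.swap)
  also have "\<dots> = (\<Sum>d\<in>I. (-1) ^ card (prime_factors d) *
       real (card {n \<in> S. real n \<le> x \<and> unitary_divisor d n}) ^ k)"
  proof (intro sum.cong refl)
    fix d
    have "(\<Sum>ns\<in>tuples S k x. if d \<in> common_unitary_divisors ns
       then (-1) ^ card (prime_factors d) else 0 :: real) =
       (-1) ^ card (prime_factors d) * real (card {ns\<in>tuples S k x. d \<in> common_unitary_divisors ns})"
      using finite_tuples by (simp add: sum.If_cases Int_def)
    also have "{ns\<in>tuples S k x. d \<in> common_unitary_divisors ns} =
      {ns. set ns \<subseteq> {n \<in> S. real n \<le> x \<and> unitary_divisor d n} \<and> length ns = k}"
      unfolding tuples_eq[OF S] common_unitary_divisors_def by auto
    also have "card \<dots> = card {n \<in> S. real n \<le> x \<and> unitary_divisor d n} ^ k"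
      by (rule card_lists_length_eq,
          rule finite_subset[OF _ finite_real_le_Collect[where Q = "\<lambda>_. True"]]) auto
    finally show "(\<Sum>ns\<in>tuples S k x. if d \<in> common_unitary_divisors ns
       then (-1) ^ card (prime_factors d) else 0 :: real) = (-1) ^ card (prime_factors d) *
       real (card {n \<in> S. real n \<le> x \<and> unitary_divisor d n}) ^ k" by simp
  qed
  \<comment> \<open>For \<open>d \<notin> S\<close> the count is 0, and \<open>0 ^ k\<close>
    vanishes since \<open>k > 0\<close>.\<close>
  also have "\<dots> = (\<Sum>d\<in>I. if d \<in> S then (-1) ^ card (prime_factors d) *
       real (sieved_count S (prime_factors d) (x / real d)) ^ k else 0)"
    using k by (intro sum.cong refl) (auto simp: I_def card_unitary_multiples[OF S] power_0_left)
  also have "\<dots> = (\<Sum>d\<in>{d\<in>I. d \<in> S}. (-1) ^ card (prime_factors d) *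
       real (sieved_count S (prime_factors d) (x / real d)) ^ k)"
    by (subst sum.inter_filter) (auto simp: I_def)
  finally show ?thesis by (simp add: I_def)
qed

section \<open>The Euler product\<close>

text \<open>Telescoping: \<open>1 / (M + 1)^2 \<le> 1 / M - 1 / (M + 1)\<close>. Arbitrary finite
  sets are allowed because infinite sums are bounded through their finite partial sums.\<close>

lemma sum_inverse_squares_tail:
  fixes F :: "nat set"
  assumes "finite F" "F \<subseteq> {N<..}" "N > 0"
  shows "(\<Sum>d\<in>F. 1 / real d ^ 2) \<le> 1 / real N"
proof -
  have *: "(\<Sum>d\<in>{N<..M}. 1 / real d ^ 2) \<le> 1 / real N - 1 / real M" if "M \<ge> N" for M
    using that
  proof (induction M rule: dec_induct)
    case (step M)
    have M: "real M > 0" using step assms by simp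
    have "{N<..Suc M} = insert (Suc M) {N<..M}" using step by auto
    moreover have "1 / real (Suc M) ^ 2 \<le> 1 / real M - 1 / real (Suc M)"
    proof -
      have "1 / real M - 1 / real (Suc M) = 1 / (real M * real (Suc M))"
        using M by (simp add: field_simps)
      also have "\<dots> \<ge> 1 / real (Suc M) ^ 2"
        unfolding power2_eq_square using M by (intro divide_left_mono mult_right_mono) auto
      finally show ?thesis .
    qed
    ultimately show ?case using step by simp
  qed simp
  define M where "M = Max (insert N F)"
  have "F \<subseteq> {N<..M}" using assms by (auto simp: M_def)
  then have "(\<Sum>d\<in>F. 1 / real d ^ 2) \<le> (\<Sum>d\<in>{N<..M}. 1 / real d ^ 2)"
    by (intro sum_mono2) auto
  also have "\<dots> \<le> 1 / real N - 1 / real M" using assms by (intro *) (simp add: M_def)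
  also have "\<dots> \<le> 1 / real N" by simp
  finally show ?thesis .
qed

text \<open>The term at \<open>d\<close> of a Dirichlet series whose multiplicative coefficients
  take the same value \<open>c p\<close> at all positive powers of \<open>p\<close>. For
  \<open>k > 0\<close> the term at 0 is 0, by division by zero.\<close>

definition prime_weight :: "(nat \<Rightarrow> real) \<Rightarrow> nat \<Rightarrow> nat \<Rightarrow> real" where
  "prime_weight c k d = (\<Prod>p\<in>prime_factors d. c p) / real d ^ k"

lemma summable_on_inverse_power:
  assumes "k \<ge> (2::nat)"
  shows "(\<lambda>d. 1 / real d ^ k) summable_on A"
proof -
  have "(\<lambda>d. 1 / real d ^ k) summable_on UNIV"
    using inverse_power_summable[OF assms, where ?'a = real]
    by (intro summable_nonneg_imp_summable_on) (auto simp: inverse_eq_divide)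
  then show ?thesis by (rule summable_on_subset_banach) simp
qed

lemma norm_prime_weight_le:
  assumes "\<And>p. \<bar>c p\<bar> \<le> 1"
  shows "norm (prime_weight c k d) \<le> 1 / real d ^ k"
proof -
  have "\<bar>\<Prod>p\<in>prime_factors d. c p\<bar> \<le> 1"
    unfolding abs_prod using assms by (intro prod_le_1) auto
  then show ?thesis
    by (simp add: prime_weight_def abs_divide power_abs divide_right_mono)
qed

lemma abs_summable_on_prime_weight:
  assumes "\<And>p. \<bar>c p\<bar> \<le> 1" "k \<ge> 2"
  shows "(\<lambda>d. norm (prime_weight c k d)) summable_on A"
  by (rule Infinite_Sum.abs_summable_on_comparison_test'[OF summable_on_inverse_power[OF assms(2)]])
    (rule norm_prime_weight_le[OF assms(1)])

lemma summable_on_prime_weight: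
  assumes "\<And>p. \<bar>c p\<bar> \<le> 1" "k \<ge> 2"
  shows "prime_weight c k summable_on A"
  using abs_summable_on_prime_weight[OF assms] by (rule abs_summable_summable)

text \<open>\<open>A\<close> may be any set beyond \<open>N\<close>, as the bound serves both the
  full tail and the set of numbers having some prime factor outside a finite set.\<close>

lemma prime_weight_tail:
  assumes c: "\<And>p. \<bar>c p\<bar> \<le> 1" and k: "k \<ge> 2" and N: "N > 0" and A: "A \<subseteq> {N<..}"
  shows "\<bar>infsum (prime_weight c k) A\<bar> * real N ^ (k - 1) \<le> 1"
proof -
  have "norm (infsum (prime_weight c k) A) \<le> (\<Sum>\<^sub>\<infinity>d\<in>A. norm (prime_weight c k d))"
    by (rule norm_infsum_bound[OF abs_summable_on_prime_weight[OF c k]])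
  also have "\<dots> \<le> 1 / real N ^ (k - 1)"
  proof (rule infsum_le_finite_sums[OF abs_summable_on_prime_weight[OF c k]])
    fix F assume F: "finite F" "F \<subseteq> A"
    \<comment> \<open>Two of the \<open>k\<close> powers of \<open>d\<close> feed the telescoping
      bound; the other \<open>k - 2\<close> are estimated by powers of \<open>N\<close>.\<close>
    have kk: "k = 2 + (k - 2)" "k - 1 = 1 + (k - 2)" using k by auto
    have "(\<Sum>d\<in>F. norm (prime_weight c k d)) \<le> (\<Sum>d\<in>F. 1 / real d ^ 2 / real N ^ (k - 2))"
    proof (rule sum_mono)
      fix d assume "d \<in> F"
      then have d: "d > N" using F A by auto
      have "1 / real d ^ k = 1 / real d ^ 2 / real d ^ (k - 2)"
        by (subst kk(1)) (simp add: power_add power2_eq_square)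
      also have "\<dots> \<le> 1 / real d ^ 2 / real N ^ (k - 2)"
        using d N by (intro divide_left_mono power_mono mult_pos_pos zero_less_power) auto
      finally show "norm (prime_weight c k d) \<le> 1 / real d ^ 2 / real N ^ (k - 2)"
        using norm_prime_weight_le[of c k d, OF c] by linarith
    qed
    also have "\<dots> = (\<Sum>d\<in>F. 1 / real d ^ 2) / real N ^ (k - 2)" by (simp add: sum_divide_distrib)
    also have "\<dots> \<le> 1 / real N / real N ^ (k - 2)"
      using F A N by (intro divide_right_mono sum_inverse_squares_tail) auto
    also have "\<dots> = 1 / real N ^ (k - 1)" by (subst kk(2)) (simp add: power_add)
    finally show "(\<Sum>d\<in>F. norm (prime_weight c k d)) \<le> 1 / real N ^ (k - 1)" .
  qed
  finally show ?thesis using N by (simp add: field_simps)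
qed

text \<open>Adding a prime \<open>p\<close> to \<open>P\<close> adds the multiples of \<open>p\<close>, and rescaling these by \<open>p\<close> gives a linear
  equation for their total weight.\<close>

lemma infsum_prime_weight_finite_primes:
  assumes c: "\<And>p. \<bar>c p\<bar> \<le> 1" and k: "k \<ge> 2" and P: "finite P" "\<forall>p\<in>P. prime p"
  shows "infsum (prime_weight c k) {d. d > 0 \<and> prime_factors d \<subseteq> P} =
    (\<Prod>p\<in>P. 1 + c p / (real p ^ k - 1))"
  using P
proof (induction P)
  case empty
  have "{d::nat. d > 0 \<and> prime_factors d \<subseteq> {}} = {1}"
    by (auto simp: prime_factorization_empty_iff)
  then show ?case by (simp add: prime_weight_def)
next
  case (insert p P)
  define g where "g = prime_weight c k"
  define D where "D = {d::nat. d > 0 \<and> prime_factors d \<subseteq> P}"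
  define D' where "D' = {d::nat. d > 0 \<and> prime_factors d \<subseteq> insert p P}"
  define M where "M = (\<lambda>d. p * d) ` D'"
  have p: "prime p" using insert by simp
  have p1: "real p > 1" using p prime_gt_1_nat by simp
  have ppos: "p > 0" using p by (simp add: prime_gt_0_nat)
  have pf: "prime_factors (p * d) = insert p (prime_factors d)" if "d > 0" for d
    using that p ppos by (simp add: prime_factors_product prime_prime_factors)
  have sm: "g summable_on X" for X unfolding g_def by (rule summable_on_prime_weight[OF c k])
  have D'_eq: "D' = D \<union> M"
  proof (intro equalityI subsetI)
    fix d assume d: "d \<in> D'"
    show "d \<in> D \<union> M"
    proof (cases "p dvd d")
      case True
      then obtain r where r: "d = p * r" by auto
      then have "r > 0" using d by (auto simp: D'_def intro: Nat.gr0I)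
      then show ?thesis using d r pf[of r] by (auto simp: D'_def M_def)
    next
      case False
      then have "p \<notin> prime_factors d" by auto
      then show ?thesis using d by (auto simp: D'_def D_def)
    qed
  next
    fix d assume "d \<in> D \<union> M"
    then show "d \<in> D'" using pf ppos by (auto simp: D_def D'_def M_def)
  qed
  have disj: "D \<inter> M = {}"
    using insert.hyps pf by (auto simp: D_def M_def D'_def)
  \<comment> \<open>A prime new to \<open>d\<close> contributes \<open>c p\<close> besides the
    scaling by \<open>p ^ k\<close>; for a prime already present, in \<open>gM\<close>, only the
    scaling remains.\<close>
  have gD: "g (p * d) = c p / real p ^ k * g d" if "d \<in> D" for d
  proof -
    have "p \<notin> prime_factors d" "d > 0" using that insert.hyps by (auto simp: D_def)
    then show ?thesis by (simp add: g_def prime_weight_def pf power_mult_distrib)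
  qed
  have gM: "g (p * d) = 1 / real p ^ k * g d" if "d \<in> M" for d
  proof -
    have d: "d > 0" using that ppos by (auto simp: M_def D'_def)
    moreover have "p \<in> prime_factors d" using that pf by (auto simp: M_def D'_def)
    ultimately show ?thesis
      by (simp add: g_def prime_weight_def pf power_mult_distrib insert_absorb)
  qed
  have U: "infsum g D' = infsum g D + infsum g M"
    unfolding D'_eq by (rule infsum_Un_disjoint[OF sm sm disj])
  \<comment> \<open>\<open>M\<close> is a copy of \<open>D'\<close>, which itself splits into
    \<open>D\<close> and \<open>M\<close>; so the weight of \<open>M\<close> is expressed through
    itself.\<close>
  have "infsum g M = (\<Sum>\<^sub>\<infinity>d\<in>D'. g (p * d))"
    unfolding M_def using ppos by (subst infsum_reindex) (auto simp: inj_on_def o_def)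
  also have "\<dots> = (\<Sum>\<^sub>\<infinity>d\<in>D. g (p * d)) + (\<Sum>\<^sub>\<infinity>d\<in>M. g (p * d))"
    unfolding D'_eq
  proof (rule infsum_Un_disjoint[OF _ _ disj])
    show "(\<lambda>d. g (p * d)) summable_on D"
      using summable_on_cmult_right[OF sm, of "c p / real p ^ k" D] gD
      by (subst summable_on_cong[where g = "\<lambda>d. c p / real p ^ k * g d"]) auto
    show "(\<lambda>d. g (p * d)) summable_on M"
      using summable_on_cmult_right[OF sm, of "1 / real p ^ k" M] gM
      by (subst summable_on_cong[where g = "\<lambda>d. 1 / real p ^ k * g d"]) auto
  qed
  also have "(\<Sum>\<^sub>\<infinity>d\<in>D. g (p * d)) = c p / real p ^ k * infsum g D"
    by (subst infsum_cmult_right[OF sm, symmetric]) (rule infsum_cong[OF gD])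
  also have "(\<Sum>\<^sub>\<infinity>d\<in>M. g (p * d)) = 1 / real p ^ k * infsum g M"
    by (subst infsum_cmult_right[OF sm, symmetric]) (rule infsum_cong[OF gM])
  finally have W: "infsum g M = c p / real p ^ k * infsum g D + 1 / real p ^ k * infsum g M" .
  \<comment> \<open>Solving the equation \<open>W\<close> for \<open>infsum g M\<close> divides by
    \<open>real p ^ k - 1\<close>.\<close>
  have pk: "real p ^ k > 1" using p1 k by (intro one_less_power) auto
  have "infsum g M * real p ^ k =
      (c p / real p ^ k * infsum g D + 1 / real p ^ k * infsum g M) * real p ^ k"
    by (rule arg_cong[OF W])
  also have "\<dots> = c p * infsum g D + infsum g M" using ppos by (simp add: field_simps)
  finally have "infsum g M * (real p ^ k - 1) = c p * infsum g D" by (simp add: algebra_simps)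
  then have "infsum g M = c p / (real p ^ k - 1) * infsum g D"
    using pk by (simp add: field_simps)
  then have "infsum g D' = (1 + c p / (real p ^ k - 1)) * infsum g D"
    using U by (simp add: algebra_simps)
  moreover have "infsum g D = (\<Prod>p\<in>P. 1 + c p / (real p ^ k - 1))"
    unfolding g_def D_def using insert by simp
  ultimately show ?case using insert.hyps by (simp add: g_def D'_def)
qed

text \<open>The product over \<open>p \<le> N\<close> is the sum over all \<open>d\<close> built
  from these primes. Every positive \<open>d \<le> N\<close> is of this kind, so the missing terms
  lie beyond \<open>N\<close> and contribute at most \<open>1 / N\<close>.\<close>

lemma infsum_prime_weight_LIMSEQ:
  assumes c: "\<And>p. \<bar>c p\<bar> \<le> 1" and k: "k \<ge> 2"
  shows "(\<lambda>N. \<Prod>p | p \<le> N \<and> prime p. 1 + c p / (real p ^ k - 1))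
    \<longlonglongrightarrow> infsum (prime_weight c k) {0<..}"
proof (rule LIM_zero_cancel, rule Lim_null_comparison)
  define P where "P = (\<lambda>N. {p::nat. p \<le> N \<and> prime p})"
  define g where "g = prime_weight c k"
  show "(\<lambda>N. 1 / real N) \<longlonglongrightarrow> 0" by (rule lim_1_over_n)
  have sm: "g summable_on X" for X unfolding g_def by (rule summable_on_prime_weight[OF c k])
  show "\<forall>\<^sub>F N in sequentially. norm ((\<Prod>p | p \<le> N \<and> prime p. 1 + c p / (real p ^ k - 1)) -
     infsum (prime_weight c k) {0<..}) \<le> 1 / real N"
    using eventually_gt_at_top[of 0]
  proof eventually_elim
    case (elim N)
    define D where "D = {d::nat. d > 0 \<and> prime_factors d \<subseteq> P N}"
    have "d \<in> D" if "d > 0" "d \<le> N" for d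
    proof -
      have "prime p \<and> p \<le> N" if p: "p \<in> prime_factors d" for p
      proof
        show "prime p" using p by (rule in_prime_factors_imp_prime)
        have "p \<le> d" using in_prime_factors_imp_dvd[OF p] \<open>d > 0\<close> by (rule dvd_imp_le)
        then show "p \<le> N" using \<open>d \<le> N\<close> by simp
      qed
      then show ?thesis using \<open>d > 0\<close> unfolding D_def P_def by blast
    qed
    then have sub: "{0<..} - D \<subseteq> {N<..}"
      using not_le_imp_less by blast
    have "infsum g {0<..} = infsum g (D \<union> ({0<..} - D))"
      by (rule arg_cong[of _ _ "infsum g"]) (auto simp: D_def)
    also have "\<dots> = infsum g D + infsum g ({0<..} - D)"
      by (rule infsum_Un_disjoint[OF sm sm]) auto
    also have "infsum g D = (\<Prod>p\<in>P N. 1 + c p / (real p ^ k - 1))"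
      unfolding g_def D_def
      by (rule infsum_prime_weight_finite_primes[OF c k]) (auto simp: P_def)
    finally have "norm ((\<Prod>p\<in>P N. 1 + c p / (real p ^ k - 1)) - infsum g {0<..}) =
      \<bar>infsum g ({0<..} - D)\<bar>" by simp
    also have "\<dots> \<le> 1 / real N"
    proof -
      have "\<bar>infsum g ({0<..} - D)\<bar> * real N \<le> \<bar>infsum g ({0<..} - D)\<bar> * real N ^ (k - 1)"
        using elim k self_le_power[of "real N" "k - 1"] by (intro mult_left_mono) auto
      also have "\<dots> \<le> 1" unfolding g_def by (rule prime_weight_tail[OF c k elim sub])
      finally show ?thesis using elim by (simp add: field_simps)
    qed
    finally show ?case by (simp add: P_def g_def)
  qed
qed

text \<open>The minus is the sign that one prime factor of \<open>d\<close> contributes, and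
  \<open>1 - 1 / p\<close> is the sieve density in each of the \<open>k\<close> coordinates. For
  primes in \<open>S\<close>, \<open>1 + c p / (p^k - 1)\<close> with this coefficient is
  \<open>gcud_factor\<close>.\<close>

definition gcud_coeff :: "nat \<Rightarrow> nat set \<Rightarrow> nat \<Rightarrow> real" where
  "gcud_coeff k S p = (if prime p \<and> p \<in> S then - ((1 - 1 / real p) ^ k) else 0)"

lemma abs_gcud_coeff_le: "\<bar>gcud_coeff k S p\<bar> \<le> 1"
proof (cases "prime p")
  case True
  then have "0 \<le> 1 - 1 / real p" "1 - 1 / real p \<le> 1" using prime_gt_0_nat[of p] by auto
  then have "\<bar>(1 - 1 / real p) ^ k\<bar> \<le> 1" by (simp add: power_le_one)
  then show ?thesis by (simp add: gcud_coeff_def)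
qed (simp add: gcud_coeff_def)

text \<open>Absolute convergence makes \<open>prodinf\<close> the limit of its partial products.
  Indices that are not prime contribute 1, which leaves the finite Euler products whose limit is
  known.\<close>

lemma gcud_beta_eq_infsum:
  assumes k: "k \<ge> 2"
  shows "gcud_beta k S = infsum (prime_weight (gcud_coeff k S) k) {0<..}"
proof -
  have "(\<lambda>N. \<Prod>p\<le>N. gcud_factor k S p) \<longlonglongrightarrow> gcud_beta k S"
    unfolding gcud_beta_def using k
    by (intro convergent_prod_LIMSEQ abs_convergent_prod_imp_convergent_prod
        abs_convergent_prod_gcud_factor)
  moreover have "(\<Prod>p\<le>N. gcud_factor k S p) =
      (\<Prod>p | p \<le> N \<and> prime p. 1 + gcud_coeff k S p / (real p ^ k - 1))" for N
  proof (rule prod.mono_neutral_cong_right)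
    fix p assume p: "p \<in> {p. p \<le> N \<and> prime p}"
    then have "real p > 0" by (simp add: prime_gt_0_nat)
    then have "1 - 1 / real p = (real p - 1) / real p" by (simp add: field_simps)
    then have "(1 - 1 / real p) ^ k = (real p - 1) ^ k / real p ^ k" by (simp add: power_divide)
    then show "gcud_factor k S p = 1 + gcud_coeff k S p / (real p ^ k - 1)"
      using p by (simp add: gcud_factor_def gcud_coeff_def)
  qed (auto simp: gcud_factor_def)
  ultimately show ?thesis
    using infsum_prime_weight_LIMSEQ[of "gcud_coeff k S" k, OF abs_gcud_coeff_le k] LIMSEQ_unique
    by auto
qed

section \<open>Error estimates\<close>

text \<open>Each set of prime factors of \<open>d\<close> has as its product a divisor of
  \<open>d\<close>, and \<open>prime_factors\<close> recovers the set from the product.\<close>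

lemma two_power_card_prime_factors_le:
  assumes "d > (0::nat)"
  shows "2 ^ card (prime_factors d) \<le> card {m. m dvd d}"
proof -
  have "inj_on (\<lambda>R. \<Prod>p\<in>R. p) (Pow (prime_factors d))"
  proof (rule inj_on_inverseI)
    fix R assume "R \<in> Pow (prime_factors d)"
    then have R: "finite R" "\<And>p. p \<in> R \<Longrightarrow> prime p" by (auto dest: finite_subset)
    have "multiplicity p (\<Prod>p\<in>R. p) = (if p \<in> R then 1 else 0)" if "prime p" for p
      using multiplicity_prod_prime_powers[OF R that, of "\<lambda>_. 1"] by simp
    then show "prime_factors (\<Prod>p\<in>R. p) = R"
      using R by (auto simp: prime_factors_multiplicity split: if_splits)
  qed
  moreover have "(\<lambda>R. \<Prod>p\<in>R. p) ` Pow (prime_factors d) \<subseteq> {m. m dvd d}"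
  proof clarify
    fix R assume "R \<subseteq> prime_factors d"
    then have "(\<Prod>p\<in>R. p) dvd (\<Prod>p\<in>prime_factors d. p)" by (intro prod_dvd_prod_subset) auto
    also have "\<dots> dvd (\<Prod>p\<in>prime_factors d. p ^ multiplicity p d)"
      by (intro prod_dvd_prod) (auto simp: prime_factors_multiplicity)
    also have "\<dots> = d" using assms by (simp add: prod_prime_factors)
    finally show "(\<Prod>p\<in>R. p) dvd d" .
  qed
  ultimately have "card (Pow (prime_factors d)) \<le> card {m. m dvd d}"
    using assms by (intro card_inj_on_le[where f = "\<lambda>R. \<Prod>p\<in>R. p"]) auto
  then show ?thesis by (simp add: card_Pow)
qed

text \<open>After passing to the number of divisors, the sum runs over pairs
  \<open>d = m * e\<close>, whose terms factor; letting \<open>m\<close> and \<open>e\<close> range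
  freely up to \<open>N\<close> gives the square.\<close>

lemma sum_two_power_card_prime_factors_le:
  "(\<Sum>d\<in>{1..N}. 2 ^ card (prime_factors d) / real d ^ s) \<le> (\<Sum>m\<in>{1..N}. 1 / real m ^ s)\<^sup>2"
proof -
  have "(\<Sum>d\<in>{1..N}. 2 ^ card (prime_factors d) / real d ^ s) \<le>
      (\<Sum>d\<in>{1..N}. \<Sum>m\<in>{m. m dvd d}. 1 / real d ^ s)"
  proof (rule sum_mono)
    fix d assume "d \<in> {1..N}"
    then have "real (2 ^ card (prime_factors d)) \<le> real (card {m. m dvd d})"
      by (intro of_nat_mono two_power_card_prime_factors_le) auto
    then show "2 ^ card (prime_factors d) / real d ^ s \<le> (\<Sum>m\<in>{m. m dvd d}. 1 / real d ^ s)"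
      by (simp add: divide_right_mono)
  qed
  also have "\<dots> = (\<Sum>(d, m)\<in>Sigma {1..N} (\<lambda>d. {m. m dvd d}). 1 / real d ^ s)"
    by (rule sum.Sigma) auto
  also have "\<dots> \<le> (\<Sum>(m, e)\<in>{1..N} \<times> {1..N}. 1 / real m ^ s * (1 / real e ^ s))"
  \<comment> \<open>Each \<open>(d, m)\<close> only needs one preimage under \<open>i\<close>,
    namely \<open>(m, e)\<close> with \<open>e = d / m\<close>. The pairs with
    \<open>m * e > N\<close> merely add nonnegative terms.\<close>
  proof (rule sum_le_included[where i = "\<lambda>(m, e). (m * e, m)"], goal_cases)
    case 1
    show ?case by (intro finite_SigmaI) auto
  next
    case 2
    show ?case by simp
  next
    case 3
    show ?case by (simp add: case_prod_beta)
  next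
    case 4
    have "\<exists>e\<in>{1..N}. m \<in> {1..N} \<and> d = m * e" if "1 \<le> d" "d \<le> N" "m dvd d" for d m
    proof -
      obtain e where e: "d = m * e" using \<open>m dvd d\<close> by auto
      have "m > 0" "e > 0" using e that by (auto intro!: Nat.gr0I)
      moreover have "m \<le> d" "e \<le> d"
        using that(1) by (auto simp: e intro: dvd_imp_le)
      moreover from this have "m \<le> N" "e \<le> N" using \<open>d \<le> N\<close> by linarith+
      ultimately show ?thesis using e by (intro bexI[of _ e]) auto
    qed
    note divisor_pair = this
    show ?case
    proof (rule ballI)
      fix z assume "z \<in> Sigma {1..N} (\<lambda>d. {m. m dvd d})"
      then obtain d m where z: "z = (d, m)" "1 \<le> d" "d \<le> N" "m dvd d" by auto
      then obtain e where "e \<in> {1..N}" "m \<in> {1..N}" "d = m * e"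
        using divisor_pair by blast
      then show "\<exists>y\<in>{1..N} \<times> {1..N}. (case y of (m, e) \<Rightarrow> (m * e, m)) = z \<and>
          (case z of (d, m) \<Rightarrow> 1 / real d ^ s) \<le> (case y of (m, e) \<Rightarrow> 1 / real m ^ s * (1 / real e ^ s))"
        by (intro bexI[of _ "(m, e)"]) (simp_all add: z power_mult_distrib)
    qed
  qed
  also have "\<dots> = (\<Sum>m\<in>{1..N}. 1 / real m ^ s)\<^sup>2"
    by (simp add: power2_eq_square sum_product sum.cartesian_product)
  finally show ?thesis .
qed

text \<open>Division by \<open>M\<close> moves both numbers into the unit ball, where
  \<open>norm_power_diff\<close> applies; \<open>M \<le> 0\<close> forces both to be 0.\<close>

lemma abs_power_diff_le:
  fixes a b M :: real
  assumes "\<bar>a\<bar> \<le> M" "\<bar>b\<bar> \<le> M" "k > 0"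
  shows "\<bar>a ^ k - b ^ k\<bar> \<le> real k * M ^ (k - 1) * \<bar>a - b\<bar>"
proof (cases "M > 0")
  case True
  have "norm ((a / M) ^ k - (b / M) ^ k) \<le> real k * norm (a / M - b / M)"
    using assms True by (intro norm_power_diff) auto
  moreover have "(a / M) ^ k - (b / M) ^ k = (a ^ k - b ^ k) / M ^ k"
    by (simp add: power_divide diff_divide_distrib)
  moreover have "a / M - b / M = (a - b) / M" by (simp add: diff_divide_distrib)
  ultimately have "\<bar>a ^ k - b ^ k\<bar> / M ^ k \<le> real k * \<bar>a - b\<bar> / M"
    using True by (simp add: abs_divide)
  moreover have "M ^ k = M ^ (k - 1) * M" using assms(3) by (simp add: power_eq_if)
  ultimately show ?thesis using True by (simp add: field_simps)
next
  case False
  then have "a = 0" "b = 0" using assms by auto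
  then show ?thesis by simp
qed

lemma sieved_count_le:
  assumes S: "completely_multiplicative_set S" and y: "y \<ge> 0"
  shows "real (sieved_count S P y) \<le> y"
proof -
  have "{m \<in> S. real m \<le> y \<and> (\<forall>p\<in>P. \<not> p dvd m)} \<subseteq> {1..nat \<lfloor>y\<rfloor>}"
    using completely_multiplicative_set_pos[OF S] by (auto simp: le_nat_floor Suc_le_eq)
  then have "sieved_count S P y \<le> card {1..nat \<lfloor>y\<rfloor>}"
    unfolding sieved_count_def by (intro card_mono) auto
  then have "real (sieved_count S P y) \<le> real (nat \<lfloor>y\<rfloor>)" by simp
  also have "\<dots> \<le> y" using y by (rule of_nat_floor)
  finally show ?thesis .
qed

text \<open>One prime factor outside \<open>S\<close> annihilates the product, so the weight carries
  the indicator of \<open>S\<close> by itself.\<close>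

lemma prime_weight_gcud_coeff:
  assumes S: "completely_multiplicative_set S" and d: "d > 0"
  shows "prime_weight (gcud_coeff k S) k d =
    (if d \<in> S then (-1) ^ card (prime_factors d) * (\<Prod>p\<in>prime_factors d. 1 - 1 / real p) ^ k / real d ^ k
     else 0)"
proof (cases "d \<in> S")
  case True
  then have "prime_factors d \<subseteq> S"
    using completely_multiplicative_set_iff_prime_factors[OF S d] by simp
  then have "(\<Prod>p\<in>prime_factors d. gcud_coeff k S p) =
      (\<Prod>p\<in>prime_factors d. - ((1 - 1 / real p) ^ k))"
    by (intro prod.cong) (auto simp: gcud_coeff_def)
  then show ?thesis using True
    by (simp add: prime_weight_def prod_uminus prod_power_distrib)
next
  case False
  then obtain p where "p \<in> prime_factors d" "p \<notin> S"
    using completely_multiplicative_set_iff_prime_factors[OF S d] by auto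
  then have "(\<Prod>p\<in>prime_factors d. gcud_coeff k S p) = 0"
    by (intro prod_zero) (auto simp: gcud_coeff_def)
  then show ?thesis using False by (simp add: prime_weight_def)
qed

text \<open>Each count \<open>a d\<close> is replaced by its main term \<open>b d\<close>. Both are
  \<open>O(x / d)\<close> and differ by \<open>O(2 ^ card (prime_factors d))\<close>, so their
  \<open>k\<close>-th powers differ by the product of that with
  \<open>(x / d)^(k-1)\<close>.\<close>

lemma gcud_count_main_estimate:
  assumes S: "completely_multiplicative_set S" and k: "k \<ge> 2"
    and C: "\<And>y. y \<ge> 0 \<Longrightarrow> \<bar>real (card {n \<in> S. real n \<le> y}) - A * y\<bar> \<le> C"
    and x: "x \<ge> 1"
  shows "\<bar>real (card {ns \<in> tuples S k x. gcud ns = 1}) -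
      A ^ k * x ^ k * (\<Sum>d\<in>{1..nat \<lfloor>x\<rfloor>}. prime_weight (gcud_coeff k S) k d)\<bar>
    \<le> real k * max 1 \<bar>A\<bar> ^ (k - 1) * C * x ^ (k - 1) * (\<Sum>m\<in>{1..nat \<lfloor>x\<rfloor>}. 1 / real m ^ (k - 1))\<^sup>2"
proof -
  define N where "N = nat \<lfloor>x\<rfloor>"
  \<comment> \<open>The maximum lets \<open>B * y\<close> dominate both the count, which is at most
    \<open>y\<close>, and its main term, which is at most \<open>\<bar>A\<bar> * y\<close>.\<close>
  define B where "B = max 1 \<bar>A\<bar>"
  define I where "I = {d\<in>{1..N}. d \<in> S}"
  define \<mu> where "\<mu> = (\<lambda>d::nat. (-1) ^ card (prime_factors d) :: real)"
  define a where "a = (\<lambda>d. real (sieved_count S (prime_factors d) (x / real d)))"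
  define \<phi> where "\<phi> = (\<lambda>d::nat. \<Prod>p\<in>prime_factors d. 1 - 1 / real p)"
  define b where "b = (\<lambda>d. A * (x / real d) * \<phi> d)"
  have C0: "C \<ge> 0" using C[of 0] by linarith
  have B: "B \<ge> 1" "\<bar>A\<bar> \<le> B" by (auto simp: B_def)
  have count: "real (card {ns \<in> tuples S k x. gcud ns = 1}) = (\<Sum>d\<in>I. \<mu> d * a d ^ k)"
    using card_gcud_tuples[OF S, of k x] k by (simp add: I_def N_def \<mu>_def a_def)
  have "A ^ k * x ^ k * (\<Sum>d\<in>{1..N}. prime_weight (gcud_coeff k S) k d) =
      (\<Sum>d\<in>{1..N}. if d \<in> S then \<mu> d * b d ^ k else 0)"
    unfolding sum_distrib_left
    by (intro sum.cong refl)
      (auto simp: prime_weight_gcud_coeff[OF S] \<mu>_def b_def \<phi>_def power_mult_distrib power_divide)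
  also have "\<dots> = (\<Sum>d\<in>I. \<mu> d * b d ^ k)"
    unfolding I_def by (subst sum.inter_filter) auto
  finally have main: "A ^ k * x ^ k * (\<Sum>d\<in>{1..N}. prime_weight (gcud_coeff k S) k d) =
      (\<Sum>d\<in>I. \<mu> d * b d ^ k)" .
  have "\<bar>(\<Sum>d\<in>I. \<mu> d * a d ^ k) - (\<Sum>d\<in>I. \<mu> d * b d ^ k)\<bar> =
      \<bar>\<Sum>d\<in>I. \<mu> d * (a d ^ k - b d ^ k)\<bar>"
    by (simp add: sum_subtractf right_diff_distrib)
  also have "\<dots> \<le> (\<Sum>d\<in>I. \<bar>\<mu> d * (a d ^ k - b d ^ k)\<bar>)" by (rule sum_abs)
  also have "\<dots> \<le> (\<Sum>d\<in>I. real k * B ^ (k - 1) * C * x ^ (k - 1) *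
      (2 ^ card (prime_factors d) / real d ^ (k - 1)))"
  proof (rule sum_mono)
    fix d assume "d \<in> I"
    then have d: "d > 0" "d \<in> S" by (auto simp: I_def)
    define y where "y = x / real d"
    have y: "y \<ge> 0" using x d by (simp add: y_def)
    have "0 \<le> \<phi> d" "\<phi> d \<le> 1"
      unfolding \<phi>_def using prime_gt_0_nat by (force intro!: prod_nonneg prod_le_1)+
    then have "\<bar>b d\<bar> \<le> \<bar>A\<bar> * y * 1"
      unfolding b_def y_def[symmetric] abs_mult using y by (intro mult_mono) auto
    also have "\<dots> \<le> B * y" using B y by (simp add: mult_right_mono)
    finally have bd: "\<bar>b d\<bar> \<le> B * y" .
    have "\<bar>a d\<bar> \<le> 1 * y"
      using sieved_count_le[OF S y] by (simp add: a_def y_def)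
    also have "\<dots> \<le> B * y" using B y by (intro mult_right_mono) auto
    finally have ad: "\<bar>a d\<bar> \<le> B * y" .
    have "\<forall>p\<in>prime_factors d. prime p \<and> p \<in> S"
      using completely_multiplicative_set_iff_prime_factors[OF S d(1)] d(2) by auto
    then have ab: "\<bar>a d - b d\<bar> \<le> C * 2 ^ card (prime_factors d)"
      unfolding a_def b_def \<phi>_def y_def[symmetric]
      by (intro sieved_count_estimate[OF S C _ _ y]) auto
    have "\<bar>\<mu> d * (a d ^ k - b d ^ k)\<bar> = \<bar>a d ^ k - b d ^ k\<bar>" by (simp add: \<mu>_def abs_mult power_abs)
    also have "\<dots> \<le> real k * (B * y) ^ (k - 1) * \<bar>a d - b d\<bar>"
      using ad bd k by (intro abs_power_diff_le) auto
    also have "\<dots> \<le> real k * (B * y) ^ (k - 1) * (C * 2 ^ card (prime_factors d))"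
      using ab B y by (intro mult_left_mono) auto
    also have "\<dots> = real k * B ^ (k - 1) * C * x ^ (k - 1) *
        (2 ^ card (prime_factors d) / real d ^ (k - 1))"
      by (simp add: y_def power_mult_distrib power_divide)
    finally show "\<bar>\<mu> d * (a d ^ k - b d ^ k)\<bar> \<le> real k * B ^ (k - 1) * C * x ^ (k - 1) *
        (2 ^ card (prime_factors d) / real d ^ (k - 1))" .
  qed
  also have "\<dots> = real k * B ^ (k - 1) * C * x ^ (k - 1) *
      (\<Sum>d\<in>I. 2 ^ card (prime_factors d) / real d ^ (k - 1))"
    by (simp add: sum_distrib_left)
  also have "\<dots> \<le> real k * B ^ (k - 1) * C * x ^ (k - 1) * (\<Sum>m\<in>{1..N}. 1 / real m ^ (k - 1))\<^sup>2"
  proof (rule mult_left_mono)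
    have "(\<Sum>d\<in>I. 2 ^ card (prime_factors d) / real d ^ (k - 1)) \<le>
        (\<Sum>d\<in>{1..N}. 2 ^ card (prime_factors d) / real d ^ (k - 1))"
      by (intro sum_mono2) (auto simp: I_def)
    then show "(\<Sum>d\<in>I. 2 ^ card (prime_factors d) / real d ^ (k - 1)) \<le>
        (\<Sum>m\<in>{1..N}. 1 / real m ^ (k - 1))\<^sup>2"
      using sum_two_power_card_prime_factors_le[of "k - 1" N] by linarith
    show "real k * B ^ (k - 1) * C * x ^ (k - 1) \<ge> 0"
      using B C0 x by (intro mult_nonneg_nonneg) auto
  qed
  finally show ?thesis using count main by (simp add: N_def B_def)
qed

text \<open>Completing the truncated series to \<open>gcud_beta\<close> adds its tail beyond
  \<open>x\<close> to the error. The summand 1 in the bound accounts for this tail, the square for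
  the sieve errors.\<close>

lemma gcud_count_error:
  assumes S: "completely_multiplicative_set S" and k: "k \<ge> 2"
    and C: "\<And>y. y \<ge> 0 \<Longrightarrow> \<bar>real (card {n \<in> S. real n \<le> y}) - A * y\<bar> \<le> C"
  shows "\<exists>K\<ge>0. \<forall>x\<ge>1.
    \<bar>real (card {ns \<in> tuples S k x. gcud ns = 1}) - A ^ k * gcud_beta k S * x ^ k\<bar>
      \<le> K * x ^ (k - 1) * (1 + (\<Sum>m\<in>{1..nat \<lfloor>x\<rfloor>}. 1 / real m ^ (k - 1))\<^sup>2)"
proof (intro exI conjI allI impI)
  define K1 where "K1 = real k * max 1 \<bar>A\<bar> ^ (k - 1) * C"
  define K2 where "K2 = \<bar>A\<bar> ^ k * 2 ^ (k - 1)"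
  have C0: "C \<ge> 0" using C[of 0] by linarith
  have K: "K1 \<ge> 0" "K2 \<ge> 0" using C0 by (auto simp: K1_def K2_def)
  then show "K1 + K2 \<ge> 0" by simp
  fix x :: real assume x: "x \<ge> 1"
  define g where "g = prime_weight (gcud_coeff k S) k"
  define N where "N = nat \<lfloor>x\<rfloor>"
  define H where "H = (\<Sum>m\<in>{1..N}. 1 / real m ^ (k - 1))\<^sup>2"
  define c where "c = real (card {ns \<in> tuples S k x. gcud ns = 1})"
  have N: "N > 0" using x by (simp add: N_def)
  \<comment> \<open>The tail bound is in terms of \<open>N\<close>; trading \<open>N\<close> for
    \<open>x\<close> costs the factor \<open>2 ^ (k - 1)\<close> in \<open>K2\<close>.\<close>
  have xN: "x \<le> 2 * real N"
  proof -
    have "x < real N + 1" using x unfolding N_def by linarith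
    then show ?thesis using N by simp
  qed
  have sm: "g summable_on X" for X
    unfolding g_def by (rule summable_on_prime_weight[OF abs_gcud_coeff_le k])
  have "gcud_beta k S = infsum g ({1..N} \<union> {N<..})"
    unfolding gcud_beta_eq_infsum[OF k] g_def
    by (rule arg_cong[where f = "infsum _"]) auto
  also have "\<dots> = (\<Sum>d\<in>{1..N}. g d) + infsum g {N<..}"
    by (subst infsum_Un_disjoint[OF sm sm]) auto
  finally have beta: "gcud_beta k S = (\<Sum>d\<in>{1..N}. g d) + infsum g {N<..}" .
  have main: "\<bar>c - A ^ k * x ^ k * (\<Sum>d\<in>{1..N}. g d)\<bar> \<le> K1 * x ^ (k - 1) * H"
    using gcud_count_main_estimate[OF S k C x] by (simp add: c_def g_def N_def K1_def H_def)
  have "\<bar>A ^ k * x ^ k * infsum g {N<..}\<bar> = \<bar>A\<bar> ^ k * x * (x ^ (k - 1) * \<bar>infsum g {N<..}\<bar>)"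
    using x k by (simp add: abs_mult power_abs power_eq_if[of x k])
  also have "\<dots> \<le> \<bar>A\<bar> ^ k * x * (2 ^ (k - 1) * 1)"
  proof (rule mult_left_mono)
    have "x ^ (k - 1) * \<bar>infsum g {N<..}\<bar> \<le> (2 * real N) ^ (k - 1) * \<bar>infsum g {N<..}\<bar>"
      using x xN by (intro mult_right_mono power_mono) auto
    also have "\<dots> = 2 ^ (k - 1) * (\<bar>infsum g {N<..}\<bar> * real N ^ (k - 1))"
      by (simp add: power_mult_distrib)
    also have "\<dots> \<le> 2 ^ (k - 1) * 1"
      unfolding g_def
      by (intro mult_left_mono prime_weight_tail[OF abs_gcud_coeff_le k N]) auto
    finally show "x ^ (k - 1) * \<bar>infsum g {N<..}\<bar> \<le> 2 ^ (k - 1) * 1" .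
  qed (use x in auto)
  also have "\<dots> = K2 * x" by (simp add: K2_def)
  also have "\<dots> \<le> K2 * x ^ (k - 1)"
    using x k K self_le_power[of x "k - 1"] by (intro mult_left_mono) auto
  finally have tail: "\<bar>A ^ k * x ^ k * infsum g {N<..}\<bar> \<le> K2 * x ^ (k - 1)" .
  have "\<bar>c - A ^ k * gcud_beta k S * x ^ k\<bar> =
      \<bar>(c - A ^ k * x ^ k * (\<Sum>d\<in>{1..N}. g d)) - A ^ k * x ^ k * infsum g {N<..}\<bar>"
    by (simp add: beta algebra_simps)
  also have "\<dots> \<le> K1 * x ^ (k - 1) * H + K2 * x ^ (k - 1)" using main tail by linarith
  also have "\<dots> \<le> (K1 + K2) * x ^ (k - 1) * H + (K1 + K2) * x ^ (k - 1)"
    using K x by (intro add_mono mult_right_mono) (auto simp: H_def)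
  finally show "\<bar>real (card {ns \<in> tuples S k x. gcud ns = 1}) - A ^ k * gcud_beta k S * x ^ k\<bar>
      \<le> (K1 + K2) * x ^ (k - 1) * (1 + (\<Sum>m\<in>{1..nat \<lfloor>x\<rfloor>}. 1 / real m ^ (k - 1))\<^sup>2)"
    by (simp add: c_def H_def N_def distrib_left)
qed

section \<open>Size of the error sums and uniformity of the hypothesis\<close>

lemma sum_inverse_power_le_ln:
  assumes "x \<ge> 1" "s > 0"
  shows "(\<Sum>m\<in>{1..nat \<lfloor>x\<rfloor>}. 1 / real m ^ s) \<le> 1 + ln x"
proof -
  define N where "N = nat \<lfloor>x\<rfloor>"
  have N: "N > 0" "real N \<le> x" using assms by (auto simp: N_def)
  have "(\<Sum>m\<in>{1..N}. 1 / real m ^ s) \<le> (\<Sum>m\<in>{1..N}. inverse (real m))"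
  proof (rule sum_mono)
    fix m assume "m \<in> {1..N}"
    then have "real m \<le> real m ^ s" "real m > 0" using assms by (auto intro: self_le_power)
    then show "1 / real m ^ s \<le> inverse (real m)"
      unfolding inverse_eq_divide by (intro divide_left_mono mult_pos_pos) auto
  qed
  also have "\<dots> = harm N" by (simp add: harm_def)
  \<comment> \<open>The sequence \<open>harm n - ln n\<close> decreases from its value 1 at
    \<open>n = 1\<close>.\<close>
  also have "\<dots> \<le> 1 + ln (real N)"
    using euler_mascheroni_sequence_decreasing[of 1 N] N by (simp add: harm_expand)
  also have "\<dots> \<le> 1 + ln x" using N by simp
  finally show ?thesis by (simp add: N_def)
qed

lemma sum_inverse_power_le_2:
  assumes "s \<ge> 2"
  shows "(\<Sum>m\<in>{1..N}. 1 / real m ^ s) \<le> 2"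
proof -
  have "(\<Sum>m\<in>{1..N}. 1 / real m ^ s) \<le> (\<Sum>m\<in>{1..N}. 1 / real m ^ 2)"
    using assms by (intro sum_mono divide_left_mono power_increasing mult_pos_pos) auto
  also have "\<dots> \<le> (\<Sum>m\<in>insert 1 {1<..N}. 1 / real m ^ 2)"
    by (rule sum_mono2) auto
  also have "\<dots> = 1 + (\<Sum>m\<in>{1<..N}. 1 / real m ^ 2)" by simp
  also have "(\<Sum>m\<in>{1<..N}. 1 / real m ^ 2) \<le> 1 / real 1"
    by (rule sum_inverse_squares_tail) auto
  finally show ?thesis by simp
qed

text \<open>The sieve evaluates the count at arbitrarily small arguments, whereas a bound
  \<open>O(1)\<close> speaks of large ones only. Between 0 and the threshold both the count and
  \<open>A * y\<close> are bounded.\<close>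

lemma uniform_count_bound:
  assumes "(\<lambda>x::real. real (card {n \<in> S. real n \<le> x}) - A * x) \<in> O[at_top](\<lambda>_. 1)"
  obtains C where "\<And>y. y \<ge> 0 \<Longrightarrow> \<bar>real (card {n \<in> S. real n \<le> y}) - A * y\<bar> \<le> C"
proof -
  obtain c where "\<forall>\<^sub>F x in at_top. norm (real (card {n \<in> S. real n \<le> x}) - A * x) \<le> c * norm (1::real)"
    using assms by (auto elim: landau_o.bigE)
  then obtain x0 where x0: "\<And>x. x \<ge> x0 \<Longrightarrow> \<bar>real (card {n \<in> S. real n \<le> x}) - A * x\<bar> \<le> c"
    by (auto simp: eventually_at_top_linorder)
  define D where "D = real (card {n \<in> S. real n \<le> x0}) + \<bar>A\<bar> * \<bar>x0\<bar>"
  show ?thesis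
  proof (rule that[of "max c D"])
    fix y :: real assume y: "y \<ge> 0"
    show "\<bar>real (card {n \<in> S. real n \<le> y}) - A * y\<bar> \<le> max c D"
    proof (cases "y \<ge> x0")
      case False
      have "card {n \<in> S. real n \<le> y} \<le> card {n \<in> S. real n \<le> x0}"
        using False
        by (intro card_mono finite_subset[OF _ finite_real_le_Collect[of x0 "\<lambda>_. True"]]) auto
      moreover have "\<bar>A * y\<bar> \<le> \<bar>A\<bar> * \<bar>x0\<bar>"
        unfolding abs_mult using False y by (intro mult_left_mono) auto
      ultimately have "\<bar>real (card {n \<in> S. real n \<le> y}) - A * y\<bar> \<le> D"
        unfolding D_def by linarith
      then show ?thesis by simp
    qed (use x0 in \<open>simp add: le_max_iff_disj\<close>)
  qed
qed

text \<open>Any element other than 1 brings infinitely many powers along. This settles the limit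
  when \<open>A \<le> 0\<close>.\<close>

lemma completely_multiplicative_set_trivial:
  assumes S: "completely_multiplicative_set S"
    and bound: "\<And>y. y \<ge> 0 \<Longrightarrow> real (card {n \<in> S. real n \<le> y}) \<le> C"
  shows "S = {1}"
proof -
  have "n = 1" if n: "n \<in> S" for n
  proof (rule ccontr)
    assume "n \<noteq> 1"
    then have n1: "n > 1" using completely_multiplicative_set_pos[OF S n] by simp
    have pow: "n ^ j \<in> S" for j
      using S n n1 completely_multiplicative_set_mult_iff[OF S, of n]
      by (induction j) (auto simp: completely_multiplicative_set_def)
    \<comment> \<open>The \<open>J + 1\<close> powers of \<open>n\<close> with exponents 0 to
      \<open>J\<close> all lie below \<open>n ^ J\<close> and exceed \<open>C\<close> in
      number.\<close>
    obtain J where J: "real J > C" using reals_Archimedean2 by blast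
    have "(\<lambda>j. n ^ j) ` {..J} \<subseteq> {m \<in> S. real m \<le> real (n ^ J)}"
      using pow n1 by (auto intro: power_increasing simp del: of_nat_power)
    then have "card ((\<lambda>j. n ^ j) ` {..J}) \<le> card {m \<in> S. real m \<le> real (n ^ J)}"
      by (intro card_mono finite_subset[OF _ finite_real_le_Collect[of "real (n ^ J)" "\<lambda>_. True"]]) auto
    moreover have "card ((\<lambda>j. n ^ j) ` {..J}) = Suc J"
      using n1 by (subst card_image) (auto simp: inj_on_def)
    ultimately show False using bound[of "real (n ^ J)"] J by simp
  qed
  moreover have "1 \<in> S" using S by (simp add: completely_multiplicative_set_def)
  ultimately show ?thesis by blast
qed

section \<open>Probabilities and the limit\<close>

lemma replicate_1_in_tuples:
  assumes "completely_multiplicative_set S" "x \<ge> 1"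
  shows "replicate k 1 \<in> tuples S k x"
  using assms by (auto simp: tuples_def completely_multiplicative_set_def)

lemma gcud_prob_eq:
  assumes S: "completely_multiplicative_set S" and n: "n > 0"
  shows "gcud_prob k S n = real (card {ns \<in> tuples S k (real n). gcud ns = 1}) /
    real (card {m \<in> S. real m \<le> real n}) ^ k"
proof -
  have "tuples S k (real n) \<noteq> {}" using replicate_1_in_tuples[OF S, of "real n" k] n by auto
  then show ?thesis unfolding gcud_prob_def
    by (subst measure_pmf_of_set) (auto simp: finite_tuples card_tuples[OF S] Int_def)
qed

lemma gcud_prob_trivial:
  assumes k: "k > 0" and n: "n > 0"
  shows "gcud_prob k {1} n = 1"
proof -
  have S: "completely_multiplicative_set {1}"
    by (auto simp: completely_multiplicative_set_def completely_multiplicative_def indicator_def)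
  have "gcud ns = 1" if ns: "ns \<in> tuples {1} k (real n)" for ns
  proof -
    have 1: "ns \<noteq> []" "\<forall>m\<in>set ns. m = 1" using ns k by (auto simp: tuples_def)
    then have "1 \<in> set ns" by (metis hd_in_set)
    then have "d = 1" if "d \<in> common_unitary_divisors ns" for d
      using that by (auto simp: common_unitary_divisors_def unitary_divisor_def)
    then have "common_unitary_divisors ns = {1}" using one_in_common_unitary_divisors by blast
    then show ?thesis using 1 by (subst gcud_eq_1_iff) auto
  qed
  then have "{ns \<in> tuples {1} k (real n). gcud ns = 1} = tuples {1} k (real n)" by auto
  moreover have "tuples {1} k (real n) \<noteq> {}"
    using replicate_1_in_tuples[OF S, of "real n" k] n by auto
  then have "card (tuples {1} k (real n)) > 0" using finite_tuples by (simp add: card_gt_0_iff)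
  moreover have "real (card {m \<in> {1}. real m \<le> real n}) ^ k = real (card (tuples {1} k (real n)))"
    by (simp only: card_tuples[OF S] of_nat_power)
  ultimately show ?thesis
    using gcud_prob_eq[OF S n, of k] n by (simp del: One_nat_def)
qed

theorem theorem2p6:
  fixes k :: nat and S :: "nat set" and A :: real
  assumes "k \<ge> 2"
    and "completely_multiplicative_set S"
    and "(\<lambda>x::real. real (card {n \<in> S. real n \<le> x}) - A * x) \<in> O[at_top](\<lambda>_. 1)"
  defines "T \<equiv> (\<lambda>x::real. real (card {ns \<in> tuples S k x. gcud ns = 1}) - A ^ k * gcud_beta k S * x ^ k)"
  shows "(k > 2 \<longrightarrow> T \<in> O[at_top](\<lambda>x. x ^ (k - 1))) \<and>
         (k = 2 \<longrightarrow> T \<in> O[at_top](\<lambda>x. x * (ln x) ^ 2)) \<and>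
         (gcud_prob k S \<longlonglongrightarrow> gcud_beta k S)"
proof -
  note k = assms(1) and S = assms(2)
  define N where "N = (\<lambda>x::real. real (card {n \<in> S. real n \<le> x}))"
  obtain C where C: "\<And>y. y \<ge> 0 \<Longrightarrow> \<bar>real (card {n \<in> S. real n \<le> y}) - A * y\<bar> \<le> C"
    using uniform_count_bound[OF assms(3)] by blast
  obtain K where K0: "K \<ge> 0" and K: "\<And>x. x \<ge> 1 \<Longrightarrow>
      \<bar>T x\<bar> \<le> K * x ^ (k - 1) * (1 + (\<Sum>m\<in>{1..nat \<lfloor>x\<rfloor>}. 1 / real m ^ (k - 1))\<^sup>2)"
    using gcud_count_error[OF S k C] unfolding T_def by blast
  \<comment> \<open>This bound holds for all \<open>k \<ge> 2\<close>: it yields the case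
    \<open>k = 2\<close> and also \<open>T(x) = o(x^k)\<close>, which the limit needs.\<close>
  have K_ln: "\<bar>T x\<bar> \<le> K * x ^ (k - 1) * (1 + (1 + ln x)\<^sup>2)" if x: "x \<ge> 1" for x
  proof -
    have "(\<Sum>m\<in>{1..nat \<lfloor>x\<rfloor>}. 1 / real m ^ (k - 1))\<^sup>2 \<le> (1 + ln x)\<^sup>2"
      using x k by (intro power_mono sum_inverse_power_le_ln sum_nonneg) auto
    then have "K * x ^ (k - 1) * (1 + (\<Sum>m\<in>{1..nat \<lfloor>x\<rfloor>}. 1 / real m ^ (k - 1))\<^sup>2) \<le>
        K * x ^ (k - 1) * (1 + (1 + ln x)\<^sup>2)"
      using K0 x by (intro mult_left_mono) auto
    then show ?thesis using K[OF x] by linarith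
  qed
  have "T \<in> O(\<lambda>x. x ^ (k - 1))" if "k > 2"
  proof (rule bigoI)
    show "\<forall>\<^sub>F x in at_top. norm (T x) \<le> (K * 5) * norm (x ^ (k - 1))"
      using eventually_ge_at_top[of 1]
    proof eventually_elim
      case (elim x)
      \<comment> \<open>Here \<open>k - 1 \<ge> 2\<close>, so the sum is at most 2, and the constant
        5 is \<open>1 + 2^2\<close>.\<close>
      have "(\<Sum>m\<in>{1..nat \<lfloor>x\<rfloor>}. 1 / real m ^ (k - 1))\<^sup>2 \<le> 2\<^sup>2"
        using that by (intro power_mono sum_inverse_power_le_2 sum_nonneg) auto
      then have "K * x ^ (k - 1) * (1 + (\<Sum>m\<in>{1..nat \<lfloor>x\<rfloor>}. 1 / real m ^ (k - 1))\<^sup>2) \<le>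
          K * x ^ (k - 1) * 5"
        using K0 elim by (intro mult_left_mono) auto
      then show ?case using K[OF elim] elim by (simp add: mult_ac)
    qed
  qed
  moreover have "T \<in> O(\<lambda>x. x * (ln x)\<^sup>2)" if "k = 2"
  proof -
    have "T \<in> O(\<lambda>x. x * (1 + (1 + ln x)\<^sup>2))"
    proof (rule bigoI)
      show "\<forall>\<^sub>F x in at_top. norm (T x) \<le> K * norm (x * (1 + (1 + ln x)\<^sup>2))"
        using eventually_ge_at_top[of 1]
      proof eventually_elim
        case (elim x)
        then show ?case using K_ln[OF elim] that by (simp add: abs_mult mult_ac)
      qed
    qed
    also have "(\<lambda>x::real. x * (1 + (1 + ln x)\<^sup>2)) \<in> O(\<lambda>x. x * (ln x)\<^sup>2)" by real_asymp
    finally show ?thesis .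
  qed
  moreover have "gcud_prob k S \<longlonglongrightarrow> gcud_beta k S"
  \<comment> \<open>Numerator and denominator of the probability are both divided by
    \<open>n ^ k\<close>; the quotient of their limits makes sense only if \<open>A ^ k\<close> is
    nonzero.\<close>
  proof (cases "A > 0")
    case True
    have "(\<lambda>n. T (real n) / real n ^ k) \<longlonglongrightarrow> 0"
    proof (rule Lim_null_comparison)
      show "\<forall>\<^sub>F n in sequentially. norm (T (real n) / real n ^ k) \<le>
          K * ((1 + (1 + ln (real n))\<^sup>2) / real n)"
        using eventually_ge_at_top[of 1]
      proof eventually_elim
        case (elim n)
        have "real n ^ k = real n ^ (k - 1) * real n" using k by (simp add: power_eq_if)
        then show ?case using K_ln[of "real n"] elim
          by (simp add: abs_mult field_simps)
      qed
      have "(\<lambda>n. (1 + (1 + ln (real n))\<^sup>2) / real n) \<longlonglongrightarrow> 0" by real_asymp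
      then show "(\<lambda>n. K * ((1 + (1 + ln (real n))\<^sup>2) / real n)) \<longlonglongrightarrow> 0"
        by (rule tendsto_mult_right_zero)
    qed
    then have num: "(\<lambda>n. A ^ k * gcud_beta k S + T (real n) / real n ^ k)
        \<longlonglongrightarrow> A ^ k * gcud_beta k S + 0"
      by (intro tendsto_intros)
    have "(\<lambda>n. N (real n) / real n - A) \<longlonglongrightarrow> 0"
    proof (rule Lim_null_comparison)
      show "\<forall>\<^sub>F n in sequentially. norm (N (real n) / real n - A) \<le> C / real n"
        using eventually_ge_at_top[of 1]
      proof eventually_elim
        case (elim n)
        then have "N (real n) / real n - A = (N (real n) - A * real n) / real n"
          by (simp add: field_simps)
        then show ?case using C[of "real n"] by (simp add: N_def abs_divide divide_right_mono)
      qed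
    qed (rule lim_const_over_n)
    then have den: "(\<lambda>n. N (real n) / real n) \<longlonglongrightarrow> A" by (rule LIM_zero_cancel)
    have "(\<lambda>n. (A ^ k * gcud_beta k S + T (real n) / real n ^ k) / (N (real n) / real n) ^ k)
        \<longlonglongrightarrow> (A ^ k * gcud_beta k S + 0) / A ^ k"
      using True by (intro tendsto_divide[OF num tendsto_power[OF den]]) auto
    moreover have "\<forall>\<^sub>F n in sequentially.
        (A ^ k * gcud_beta k S + T (real n) / real n ^ k) / (N (real n) / real n) ^ k = gcud_prob k S n"
      using eventually_gt_at_top[of 0]
    proof eventually_elim
      case (elim n)
      then have "A ^ k * gcud_beta k S + T (real n) / real n ^ k =
          real (card {ns \<in> tuples S k (real n). gcud ns = 1}) / real n ^ k"
        by (simp add: T_def field_simps)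
      then show ?case using elim
        by (simp add: gcud_prob_eq[OF S elim] N_def power_divide)
    qed
    ultimately show ?thesis using True by (simp add: tendsto_cong)
  next
    case False
    \<comment> \<open>With \<open>A \<le> 0\<close> the counting function is bounded, which leaves
      \<open>S = {1}\<close>: no prime enters the product, and the only tuple consists of ones, so
      both sides are 1.\<close>
    have "real (card {n \<in> S. real n \<le> y}) \<le> C" if "y \<ge> 0" for y
    proof -
      have "A * y \<le> 0" using False that by (simp add: mult_nonpos_nonneg)
      then show ?thesis using C[OF that] by linarith
    qed
    then have S1: "S = {1}" by (rule completely_multiplicative_set_trivial[OF S])
    have "gcud_factor k S = (\<lambda>_. 1)" by (auto simp: gcud_factor_def S1 fun_eq_iff)
    then have "gcud_beta k S = 1" by (simp add: gcud_beta_def)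
    moreover have "\<forall>\<^sub>F n in sequentially. gcud_prob k S n = 1"
      using eventually_gt_at_top[of 0] by eventually_elim (use k in \<open>simp add: S1 gcud_prob_trivial del: One_nat_def\<close>)
    ultimately show ?thesis by (simp add: tendsto_eventually)
  qed
  ultimately show ?thesis by blast
qed

end
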